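(* Let $X$ be a set and let $\mathscr{A}$ and $\mathscr{B}$ be collections of families of subsets of $X$. Then $X$ satisfies the principle $\mathbf{CS}_1(\mathscr{A},\mathscr{B})$ if and only if $X$ satisfies the principle $\mathbf{DS}_1(\mathscr{A}^c,\mathscr{B}^c)$.
   Context: For $U\subseteq X$, $U^c=X\setminus U$; for a family $\mathcal{U}$ of subsets of $X$, $\mathcal{U}^c=\{U^c:U\in\mathcal{U}\}$; for a collection $\mathscr{U}$ of families of subsets of $X$, $\mathscr{U}^c=\{\mathcal{U}^c:\mathcal{U}\in\mathscr{U}\}$. For a set $Y$, $[Y]^{<\omega}$ is the collection of all finite subsets of $Y$ (including $\emptyset$). For the empty family of subsets of $X$, $\bigcup\emptyset=\emptyset$ and $\bigcap\emptyset=X$. For collections $\mathscr{A},\mathscr{B}$ of families of subsets of $X$: $\mathbf{CS}_1(\mathscr{A},\mathscr{B})$: for any sequence $\{\mathcal{U}_n:n\in\omega\}$ of elements of $\mathscr{A}$ there is a sequence $\{U_n:n\in\omega\}$ such that $U_n\in\mathcal{U}_n$ for each $n\in\omega$, and $\bigcup\{\mathcal{V}_n:n\in\omega\}\in\mathscr{B}$, where $\mathcal{V}_n=\{\bigcup\mathcal{V}:\mathcal{V}\in[\mathcal{U}_n]^{<\omega}\text{ and }U_n\cap V\neq\emptyset\text{ for each }V\in\mathcal{V}\}$. $\mathbf{DS}_1(\mathscr{A},\mathscr{B})$: for any sequence $\{\mathcal{D}_n:n\in\omega\}$ of elements of $\mathscr{A}$ there is a sequence $\{D_n:n\in\omega\}$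 such that $D_n\in\mathcal{D}_n$ for each $n\in\omega$, and $\bigcup\{\mathcal{F}_n:n\in\omega\}\in\mathscr{B}$, where $\mathcal{F}_n=\{\bigcap\mathcal{F}:\mathcal{F}\in[\mathcal{D}_n]^{<\omega}\text{ and }D_n^c\cap E^c\neq\emptyset\text{ for each }E\in\mathcal{F}\}$. *)

theory Defs
  imports Main
begin

text \<open>Complements are relative to the ambient set \<open>X\<close>, so \<open>U\<^sup>c\<close> is \<open>X - U\<close>.\<close>

definition fam_compl :: "'a set \<Rightarrow> 'a set set \<Rightarrow> 'a set set" where
  "fam_compl X \<U> = {X - U |U. U \<in> \<U>}"

definition coll_compl :: "'a set \<Rightarrow> 'a set set set \<Rightarrow> 'a set set set" where
  "coll_compl X \<A> = {fam_compl X \<U> |\<U>. \<U> \<in> \<A>}"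

text \<open>Intersection of a family of subsets of \<open>X\<close>, with the convention that the empty
  family has intersection \<open>X\<close> (in HOL, \<open>\<Inter>{}\<close> is \<open>UNIV\<close>).\<close>

definition rel_Inter :: "'a set \<Rightarrow> 'a set set \<Rightarrow> 'a set" where
  "rel_Inter X \<F> = (if \<F> = {} then X else \<Inter>\<F>)"

text \<open>\<open>Fpow \<U>\<close> is the collection of finite subsets of \<open>\<U>\<close>, including the empty one.
  The ambient set is not a parameter of \<open>CS1\<close>, because it plays no role there beyond
  containing all the sets involved.\<close>

definition CS1 :: "'a set set set \<Rightarrow> 'a set set set \<Rightarrow> bool" where
  "CS1 \<A> \<B> \<longleftrightarrow>
    (\<forall>\<U> :: nat \<Rightarrow> 'a set set. (\<forall>n. \<U> n \<in> \<A>) \<longrightarrow>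
      (\<exists>U :: nat \<Rightarrow> 'a set. (\<forall>n. U n \<in> \<U> n) \<and>
        (\<Union>n. {\<Union>\<V> |\<V>. \<V> \<in> Fpow (\<U> n) \<and> (\<forall>V\<in>\<V>. U n \<inter> V \<noteq> {})}) \<in> \<B>))"

definition DS1 :: "'a set \<Rightarrow> 'a set set set \<Rightarrow> 'a set set set \<Rightarrow> bool" where
  "DS1 X \<A> \<B> \<longleftrightarrow>
    (\<forall>\<D> :: nat \<Rightarrow> 'a set set. (\<forall>n. \<D> n \<in> \<A>) \<longrightarrow>
      (\<exists>D :: nat \<Rightarrow> 'a set. (\<forall>n. D n \<in> \<D> n) \<and>
        (\<Union>n. {rel_Inter X \<F> |\<F>. \<F> \<in> Fpow (\<D> n) \<and>
                 (\<forall>E\<in>\<F>. (X - D n) \<inter> (X - E) \<noteq> {})}) \<in> \<B>))"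

end

theory Submission
  imports Defs
begin

text \<open>On subsets of \<open>X\<close>, complementation \<open>U \<mapsto> X - U\<close> is an involution, hence so are the induced
  maps on families and on collections of families. By De Morgan it turns unions of
  finite subfamilies into (relative) intersections of finite subfamilies, the empty subfamily
  included, because \<open>X - \<Union>{} = X\<close>. Thus the family that \<open>DS1\<close> assigns to the complements
  of \<open>\<U>\<close> and of a member \<open>U\<close> is the complement of the family that \<open>CS1\<close> assigns to
  \<open>\<U>\<close> and \<open>U\<close> (\<open>meet_family_fam_compl\<close>), and complementing sequences of families and
  of selected members carries witnesses for either principle to witnesses for the other.\<close>

text \<open>The unions of finite subfamilies of \<open>\<U>\<close> all of whose members meet \<open>U\<close>.\<close>

definition join_family :: "'a set set \<Rightarrow> 'a set \<Rightarrow> 'a set set" where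
  "join_family \<U> U = {\<Union>\<V> |\<V>. \<V> \<in> Fpow \<U> \<and> (\<forall>V\<in>\<V>. U \<inter> V \<noteq> {})}"

text \<open>The dual notion: the intersections, relative to \<open>X\<close>, of finite subfamilies of \<open>\<D>\<close> all of
  whose members have a complement that meets the complement of \<open>D\<close>.\<close>

definition meet_family :: "'a set \<Rightarrow> 'a set set \<Rightarrow> 'a set \<Rightarrow> 'a set set" where
  "meet_family X \<D> D =
    {rel_Inter X \<F> |\<F>. \<F> \<in> Fpow \<D> \<and> (\<forall>E\<in>\<F>. (X - D) \<inter> (X - E) \<noteq> {})}"

lemma CS1_iff:
  "CS1 \<A> \<B> \<longleftrightarrow>
    (\<forall>\<U>. (\<forall>n. \<U> n \<in> \<A>) \<longrightarrow>
      (\<exists>U. (\<forall>n. U n \<in> \<U> n) \<and> (\<Union>n::nat. join_family (\<U> n) (U n)) \<in> \<B>))"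
  unfolding CS1_def join_family_def ..

lemma DS1_iff:
  "DS1 X \<A> \<B> \<longleftrightarrow>
    (\<forall>\<D>. (\<forall>n. \<D> n \<in> \<A>) \<longrightarrow>
      (\<exists>D. (\<forall>n. D n \<in> \<D> n) \<and> (\<Union>n::nat. meet_family X (\<D> n) (D n)) \<in> \<B>))"
  unfolding DS1_def meet_family_def ..

lemma fam_compl_eq_image: "fam_compl X \<U> = (\<lambda>U. X - U) ` \<U>"
  unfolding fam_compl_def by blast

lemma fam_compl_UN: "fam_compl X (\<Union>i\<in>I. \<U> i) = (\<Union>i\<in>I. fam_compl X (\<U> i))"
  unfolding fam_compl_eq_image by (rule image_UN)

lemma fam_compl_fam_compl:
  assumes "\<U> \<subseteq> Pow X"
  shows "fam_compl X (fam_compl X \<U>) = \<U>"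
proof -
  have "X - (X - U) = U" if "U \<in> \<U>" for U
    using assms that by blast
  then show ?thesis
    by (simp add: fam_compl_eq_image image_image)
qed

lemma fam_compl_in_coll_compl_iff:
  assumes "\<B> \<subseteq> Pow (Pow X)" and "\<U> \<subseteq> Pow X"
  shows "fam_compl X \<U> \<in> coll_compl X \<B> \<longleftrightarrow> \<U> \<in> \<B>"
proof
  assume "fam_compl X \<U> \<in> coll_compl X \<B>"
  then obtain \<V> where \<V>: "\<V> \<in> \<B>" "fam_compl X \<U> = fam_compl X \<V>"
    unfolding coll_compl_def by blast
  have "\<V> \<subseteq> Pow X"
    using \<V>(1) assms(1) by blast
  then have "\<U> = \<V>"
    using \<V>(2) fam_compl_fam_compl assms(2) by metis
  then show "\<U> \<in> \<B>"
    using \<V>(1) by simp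
qed (auto simp: coll_compl_def)

lemma rel_Inter_fam_compl: "rel_Inter X (fam_compl X \<V>) = X - \<Union>\<V>"
  unfolding rel_Inter_def fam_compl_eq_image by auto

lemma join_family_subset_Pow:
  assumes "\<U> \<subseteq> Pow X"
  shows "join_family \<U> U \<subseteq> Pow X"
  using assms unfolding join_family_def Fpow_def by blast

lemma Fpow_fam_compl: "Fpow (fam_compl X \<U>) = fam_compl X ` Fpow \<U>"
proof
  show "Fpow (fam_compl X \<U>) \<subseteq> fam_compl X ` Fpow \<U>"
  proof
    fix \<F>
    assume "\<F> \<in> Fpow (fam_compl X \<U>)"
    then have "finite \<F>" "\<F> \<subseteq> (\<lambda>U. X - U) ` \<U>"
      unfolding Fpow_def fam_compl_eq_image by auto
    then obtain \<V> where "\<V> \<subseteq> \<U>" "finite \<V>" "\<F> = (\<lambda>U. X - U) ` \<V>"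
      by (blast dest: finite_subset_image)
    then show "\<F> \<in> fam_compl X ` Fpow \<U>"
      unfolding Fpow_def fam_compl_eq_image by blast
  qed
  show "fam_compl X ` Fpow \<U> \<subseteq> Fpow (fam_compl X \<U>)"
    unfolding Fpow_def fam_compl_eq_image by auto
qed

lemma meet_family_fam_compl:
  assumes "\<U> \<subseteq> Pow X" and "U \<subseteq> X"
  shows "meet_family X (fam_compl X \<U>) (X - U) = fam_compl X (join_family \<U> U)"
proof -
  have meets: "(\<forall>E\<in>fam_compl X \<V>. (X - (X - U)) \<inter> (X - E) \<noteq> {}) \<longleftrightarrow> (\<forall>V\<in>\<V>. U \<inter> V \<noteq> {})"
    if "\<V> \<in> Fpow \<U>" for \<V>
  proof -
    have "(X - (X - U)) \<inter> (X - (X - V)) = U \<inter> V" if "V \<in> \<V>" for V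
      using assms(2) by blast
    then show ?thesis
      by (simp add: fam_compl_eq_image)
  qed
  have "meet_family X (fam_compl X \<U>) (X - U) =
      {rel_Inter X (fam_compl X \<V>) |\<V>. \<V> \<in> Fpow \<U> \<and>
        (\<forall>E\<in>fam_compl X \<V>. (X - (X - U)) \<inter> (X - E) \<noteq> {})}"
    unfolding meet_family_def Fpow_fam_compl by blast
  also have "\<dots> = {X - \<Union>\<V> |\<V>. \<V> \<in> Fpow \<U> \<and> (\<forall>V\<in>\<V>. U \<inter> V \<noteq> {})}"
    unfolding rel_Inter_fam_compl using meets by blast
  also have "\<dots> = fam_compl X (join_family \<U> U)"
    unfolding fam_compl_def join_family_def by blast
  finally show ?thesis .
qed

lemma UN_meet_family_in_coll_compl_iff:
  assumes "\<B> \<subseteq> Pow (Pow X)" and "\<And>i. \<U> i \<subseteq> Pow X" and "\<And>i. U i \<in> \<U> i"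
  shows "(\<Union>i. meet_family X (fam_compl X (\<U> i)) (X - U i)) \<in> coll_compl X \<B> \<longleftrightarrow>
    (\<Union>i. join_family (\<U> i) (U i)) \<in> \<B>"
proof -
  have "U i \<subseteq> X" for i
    using assms(2,3) by blast
  then have "(\<Union>i. meet_family X (fam_compl X (\<U> i)) (X - U i)) =
      fam_compl X (\<Union>i. join_family (\<U> i) (U i))"
    by (simp add: meet_family_fam_compl assms(2) fam_compl_UN)
  moreover have "(\<Union>i. join_family (\<U> i) (U i)) \<subseteq> Pow X"
    using join_family_subset_Pow[OF assms(2)] by blast
  ultimately show ?thesis
    by (simp add: fam_compl_in_coll_compl_iff[OF assms(1)])
qed

theorem theorem3p7:
  fixes X :: "'a set" and \<A> \<B> :: "'a set set set"
  assumes "\<A> \<subseteq> Pow (Pow X)" and "\<B> \<subseteq> Pow (Pow X)"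
  shows "CS1 \<A> \<B> \<longleftrightarrow> DS1 X (coll_compl X \<A>) (coll_compl X \<B>)"
proof
  assume CS: "CS1 \<A> \<B>"
  show "DS1 X (coll_compl X \<A>) (coll_compl X \<B>)"
    unfolding DS1_iff
  proof (intro allI impI)
    fix \<D> :: "nat \<Rightarrow> 'a set set"
    assume "\<forall>n. \<D> n \<in> coll_compl X \<A>"
    then have "\<forall>n. \<exists>\<V>. \<V> \<in> \<A> \<and> \<D> n = fam_compl X \<V>"
      unfolding coll_compl_def by blast
    then obtain \<U> where \<U>: "\<And>n. \<U> n \<in> \<A>" "\<And>n. \<D> n = fam_compl X (\<U> n)"
      by metis
    obtain U where U: "\<And>n. U n \<in> \<U> n" "(\<Union>n. join_family (\<U> n) (U n)) \<in> \<B>"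
      using CS \<U>(1) unfolding CS1_iff by blast
    have "\<U> n \<subseteq> Pow X" for n
      using \<U>(1) assms(1) by blast
    then have "(\<Union>n. meet_family X (\<D> n) (X - U n)) \<in> coll_compl X \<B>"
      using U UN_meet_family_in_coll_compl_iff[OF assms(2), of \<U> U] by (simp add: \<U>(2))
    moreover have "\<forall>n. X - U n \<in> \<D> n"
      using U(1) by (auto simp: \<U>(2) fam_compl_eq_image)
    ultimately show "\<exists>D. (\<forall>n. D n \<in> \<D> n) \<and>
        (\<Union>n. meet_family X (\<D> n) (D n)) \<in> coll_compl X \<B>"
      by (intro exI[of _ "\<lambda>n. X - U n"]) simp
  qed
next
  assume DS: "DS1 X (coll_compl X \<A>) (coll_compl X \<B>)"
  show "CS1 \<A> \<B>"
    unfolding CS1_iff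
  proof (intro allI impI)
    fix \<U> :: "nat \<Rightarrow> 'a set set"
    assume \<U>: "\<forall>n. \<U> n \<in> \<A>"
    then have "\<forall>n. fam_compl X (\<U> n) \<in> coll_compl X \<A>"
      unfolding coll_compl_def by blast
    then obtain D where D: "\<And>n. D n \<in> fam_compl X (\<U> n)"
        "(\<Union>n. meet_family X (fam_compl X (\<U> n)) (D n)) \<in> coll_compl X \<B>"
      using DS[unfolded DS1_iff, rule_format, of "\<lambda>n. fam_compl X (\<U> n)"] by blast
    have "\<forall>n. \<exists>V. V \<in> \<U> n \<and> D n = X - V"
      using D(1) unfolding fam_compl_def by blast
    then obtain U where U: "\<And>n. U n \<in> \<U> n" "\<And>n. D n = X - U n"
      by metis
    have "\<U> n \<subseteq> Pow X" for n
      using \<U> assms(1) by blast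
    then have "(\<Union>n. join_family (\<U> n) (U n)) \<in> \<B>"
      using D(2) UN_meet_family_in_coll_compl_iff[OF assms(2), of \<U> U] U(1)
      by (simp add: U(2))
    then show "\<exists>U. (\<forall>n. U n \<in> \<U> n) \<and> (\<Union>n. join_family (\<U> n) (U n)) \<in> \<B>"
      using U(1) by blast
  qed
qed

end
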